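(* For each design matrix $W\in\mathcal{W}$, the goal-oriented expected information gain $$\Psi^\rho(W)=\frac12\log\det\left(\mathbf{I}_\rho+\mathbf{\Sigma}_{\mathrm{pr}}^{1/2}\,(\mathbf{F}(W)\mathbf{P}_\dagger)^*\,\mathbf{\Gamma}_\eta^{-1}(W)\,\mathbf{F}(W)\mathbf{P}_\dagger\,\mathbf{\Sigma}_{\mathrm{pr}}^{1/2}\right)$$ can be computed as $$\Psi^\rho(W)=\frac12\log\det\left(\mathbf{I}_r+L^TW\,\mathbf{H}_d^\rho\,W^TL\right),$$ where $\mathbf{I}_r$ is the $r\times r$ identity matrix, $$\mathbf{H}_d^\rho:=\mathbf{F}_d\mathbf{\Gamma}_{\mathrm{pr}}\mathbf{P}^*\mathbf{\Sigma}_{\mathrm{pr}}^{-1}\mathbf{P}\mathbf{\Gamma}_{\mathrm{pr}}\mathbf{F}_d^*,$$ and $L$ is given by the Cholesky factorization $\mathbf{\Gamma}_\eta^{-1}(W)=LL^T$.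
   Context: Let $d_m,d_\rho,d,r$ be positive integers with $r<d$. $d$ is the number of candidate sensors, $r$ the number of sensors to be chosen. Designs: $\mathcal{W}$ is the set of Boolean matrices $W\in\mathbb{R}^{r\times d}$ with $W_{ij}\in\{0,1\}$, $\sum_{j=1}^d W_{ij}=1$ for every $i$, and $\sum_{i=1}^r W_{ij}\in\{0,1\}$ for every $j$ ($W_{ij}=1$ means sensor $i$ is placed at candidate location $j$). Data: $\mathbf{F}_d:\mathbb{R}^{d_m}\to\mathbb{R}^d$ is a linear map (the parameter-to-observable map using all $d$ candidate sensors) and $\mathbf{P}:\mathbb{R}^{d_m}\to\mathbb{R}^{d_\rho}$ is a linear map (the parameter-to-quantity-of-interest map); $^*$ denotes the adjoint. The prior covariance $\mathbf{\Gamma}_{\mathrm{pr}}\in\mathbb{R}^{d_m\times d_m}$ is symmetric positive definite. The noise covariance for all candidate sensors is $\mathbf{\Gamma}_{\mathrm n}^d=\mathrm{diag}(\sigma_1^2,\dots,\sigma_d^2)$ with all $\sigma_i^2>0$. The prior covariance of the quantity of interest is $\mathbf{\Sigma}_{\mathrm{pr}}:=\mathbf{P}\mathbf{\Gamma}_{\mathrm{pr}}\mathbf{P}^*$, which is assumed invertible. For $W\in\mathcal{W}$ set $\mathbf{F}(W):=W\mathbf{F}_d$ (so $\mathbf{F}(W)^*=\mathbf{F}_d^*W^T$), $\mathbf{\Gamma}_{\mathrm n}(W):=W\mathbf{\Gamma}_{\mathrm n}^dW^T$, $\mathbf{P}_\dagger:=\mathbf{\Gamma}_{\mathrm{pr}}\mathbf{P}^*\mathbf{\Sigma}_{\mathrm{pr}}^{-1}$,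 and $$\mathbf{\Gamma}_\eta(W):=\mathbf{\Gamma}_{\mathrm n}(W)+\mathbf{F}(W)\left(\mathbf{\Gamma}_{\mathrm{pr}}-\mathbf{\Gamma}_{\mathrm{pr}}\mathbf{P}^*\mathbf{\Sigma}_{\mathrm{pr}}^{-1}\mathbf{P}\mathbf{\Gamma}_{\mathrm{pr}}\right)\mathbf{F}(W)^*.$$ $\mathbf{I}_\rho$ is the $d_\rho\times d_\rho$ identity matrix. *)

theory Defs
  imports
    Complex_Main
    "Jordan_Normal_Form.Determinant"
    "Jordan_Normal_Form.Gauss_Jordan_Elimination"
begin

text \<open>
  Linear maps between Euclidean spaces are identified with their matrices in the standard bases,
  so that the adjoint is the transpose. Matrix indices start at 0.
\<close>

definition mat_inv :: "real mat \<Rightarrow> real mat" where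
  \<comment> \<open>only meaningful for invertible matrices\<close>
  "mat_inv A = the (mat_inverse A)"

definition pos_semidef_mat :: "real mat \<Rightarrow> bool" where
  "pos_semidef_mat A \<longleftrightarrow> square_mat A \<and> A\<^sup>T = A \<and>
     (\<forall>x \<in> carrier_vec (dim_row A). 0 \<le> x \<bullet> (A *\<^sub>v x))"

definition pos_def_mat :: "real mat \<Rightarrow> bool" where
  "pos_def_mat A \<longleftrightarrow> square_mat A \<and> A\<^sup>T = A \<and>
     (\<forall>x \<in> carrier_vec (dim_row A). x \<noteq> 0\<^sub>v (dim_row A) \<longrightarrow> 0 < x \<bullet> (A *\<^sub>v x))"

definition mat_sqrt :: "real mat \<Rightarrow> real mat" where
  \<comment> \<open>the unique symmetric positive semidefinite square root; only meaningful for symmetric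
      positive semidefinite matrices\<close>
  "mat_sqrt A = (THE S. S \<in> carrier_mat (dim_row A) (dim_row A) \<and> pos_semidef_mat S \<and> S * S = A)"

definition is_cholesky_factor :: "real mat \<Rightarrow> real mat \<Rightarrow> bool" where
  \<comment> \<open>lower triangular with positive diagonal, the normalization that makes the factor unique\<close>
  "is_cholesky_factor A L \<longleftrightarrow> L \<in> carrier_mat (dim_row A) (dim_row A) \<and>
     (\<forall>i < dim_row A. \<forall>j < dim_row A. i < j \<longrightarrow> L $$ (i, j) = 0) \<and>
     (\<forall>i < dim_row A. 0 < L $$ (i, i)) \<and>
     A = L * L\<^sup>T"

definition designs :: "nat \<Rightarrow> nat \<Rightarrow> real mat set" where
  "designs r d = {W \<in> carrier_mat r d.
     (\<forall>i<r. \<forall>j<d. W $$ (i, j) \<in> {0, 1}) \<and>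
     (\<forall>i<r. (\<Sum>j<d. W $$ (i, j)) = 1) \<and>
     (\<forall>j<d. (\<Sum>i<r. W $$ (i, j)) \<in> {0, 1})}"

definition Sigma_pr :: "real mat \<Rightarrow> real mat \<Rightarrow> real mat" where
  "Sigma_pr P \<Gamma>\<^sub>p\<^sub>r = P * \<Gamma>\<^sub>p\<^sub>r * P\<^sup>T"

definition forward :: "real mat \<Rightarrow> real mat \<Rightarrow> real mat" where
  "forward F\<^sub>d W = W * F\<^sub>d"

definition Gamma_noise :: "nat \<Rightarrow> (nat \<Rightarrow> real) \<Rightarrow> real mat \<Rightarrow> real mat" where
  "Gamma_noise d \<sigma> W = W * mat_diag d (\<lambda>i. (\<sigma> i)\<^sup>2) * W\<^sup>T"

definition P_dagger :: "real mat \<Rightarrow> real mat \<Rightarrow> real mat" where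
  "P_dagger P \<Gamma>\<^sub>p\<^sub>r = \<Gamma>\<^sub>p\<^sub>r * P\<^sup>T * mat_inv (Sigma_pr P \<Gamma>\<^sub>p\<^sub>r)"

definition Gamma_eta ::
  "real mat \<Rightarrow> real mat \<Rightarrow> real mat \<Rightarrow> nat \<Rightarrow> (nat \<Rightarrow> real) \<Rightarrow> real mat \<Rightarrow> real mat" where
  "Gamma_eta F\<^sub>d P \<Gamma>\<^sub>p\<^sub>r d \<sigma> W =
     Gamma_noise d \<sigma> W +
     forward F\<^sub>d W *
       (\<Gamma>\<^sub>p\<^sub>r - \<Gamma>\<^sub>p\<^sub>r * P\<^sup>T * mat_inv (Sigma_pr P \<Gamma>\<^sub>p\<^sub>r) * P * \<Gamma>\<^sub>p\<^sub>r) *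
       (forward F\<^sub>d W)\<^sup>T"

definition Psi_rho ::
  "real mat \<Rightarrow> real mat \<Rightarrow> real mat \<Rightarrow> nat \<Rightarrow> (nat \<Rightarrow> real) \<Rightarrow> real mat \<Rightarrow> real" where
  "Psi_rho F\<^sub>d P \<Gamma>\<^sub>p\<^sub>r d \<sigma> W =
     1 / 2 * ln (det (1\<^sub>m (dim_row P) +
       mat_sqrt (Sigma_pr P \<Gamma>\<^sub>p\<^sub>r) * (forward F\<^sub>d W * P_dagger P \<Gamma>\<^sub>p\<^sub>r)\<^sup>T *
       mat_inv (Gamma_eta F\<^sub>d P \<Gamma>\<^sub>p\<^sub>r d \<sigma> W) *
       (forward F\<^sub>d W * P_dagger P \<Gamma>\<^sub>p\<^sub>r) * mat_sqrt (Sigma_pr P \<Gamma>\<^sub>p\<^sub>r)))"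

definition H_rho :: "real mat \<Rightarrow> real mat \<Rightarrow> real mat \<Rightarrow> real mat" where
  "H_rho F\<^sub>d P \<Gamma>\<^sub>p\<^sub>r =
     F\<^sub>d * \<Gamma>\<^sub>p\<^sub>r * P\<^sup>T * mat_inv (Sigma_pr P \<Gamma>\<^sub>p\<^sub>r) * P * \<Gamma>\<^sub>p\<^sub>r * F\<^sub>d\<^sup>T"

end

theory Submission
  imports Defs "Jordan_Normal_Form.Spectral_Radius"
begin

text \<open>
  Write \<open>\<Sigma>\<close> for the prior covariance of the quantity of interest, \<open>G = F(W) P\<^sub>\<dagger>\<close>,
  \<open>K = \<Gamma>\<^sub>\<eta>(W)\<close> and \<open>S = \<Sigma>\<^sup>1\<^sup>/\<^sup>2\<close>. With \<open>K\<^sup>-\<^sup>1 = L L\<^sup>T\<close> the matrix inside the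
  determinant of the information gain is \<open>1 + A B\<close> for \<open>A = S G\<^sup>T L\<close> and \<open>B = L\<^sup>T G S\<close>. Sylvester's
  identity \<open>det (1 + A B) = det (1 + B A)\<close> (\<open>det_one_plus_mult_commute\<close>) exchanges the factors, and
  \<open>B A = L\<^sup>T (G \<Sigma> G\<^sup>T) L\<close>, where \<open>G \<Sigma> G\<^sup>T = W H\<^sub>d\<^sup>\<rho> W\<^sup>T\<close> because the middle factor
  \<open>\<Sigma>\<^sup>-\<^sup>1 \<Sigma> \<Sigma>\<^sup>-\<^sup>1\<close> collapses to \<open>\<Sigma>\<^sup>-\<^sup>1\<close>.

  The rest justifies the objects involved. The matrix \<open>K\<close> is positive definite
  (\<open>Gamma_eta_pos_def\<close>): the noise part is, because the variances are positive and the rows of a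
  design are orthonormal, and the
  conditional covariance of the parameter given the quantity of interest is positive semidefinite.
  Hence \<open>K\<^sup>-\<^sup>1\<close> exists, is positive definite, and has a Cholesky factor
  (\<open>cholesky_factor_exists\<close>). The matrix \<open>\<Sigma>\<close> is positive semidefinite and invertible, hence positive
  definite, and has exactly one positive semidefinite square root (\<open>sqrt_mat_exists\<close>,
  \<open>sqrt_mat_unique\<close>), so that the definite description behind \<open>mat_sqrt\<close> denotes it. Both existence
  statements are inductions on the size, in which a congruence splits off the first coordinate
  (\<open>pos_def_deflate\<close>): a lower triangular elimination step for the Cholesky factor, a reflection that
  moves the first unit vector to an eigenvector for the square root.
\<close>

section \<open>Matrix algebra\<close>

text \<open>The next two laws have equations between dimensions as side conditions, which the simplifier
  can discharge for nested products; carrier conditions would contain dimensions that do not occur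
  in the equation and would have to be guessed.\<close>

lemma assoc_mult_mat_dim:
  assumes "dim_col A = dim_row B" and "dim_col B = dim_row C"
  shows "A * B * C = A * (B * (C :: 'a :: semiring_0 mat))"
  using assms by (intro assoc_mult_mat[of _ "dim_row A" "dim_row B" _ "dim_row C" _ "dim_col C"]) auto

lemma transpose_mult_dim:
  assumes "dim_col A = dim_row B"
  shows "(A * B)\<^sup>T = B\<^sup>T * (A :: 'a :: comm_semiring_0 mat)\<^sup>T"
  using assms by (intro transpose_mult[of _ "dim_row A" "dim_row B"]) auto

lemma mult_cancel_left_mat:
  assumes "A * B = 1\<^sub>m n" and "A \<in> carrier_mat n m" "B \<in> carrier_mat m n" "dim_row X = n"
  shows "A * (B * X) = (X :: 'a :: semiring_1 mat)"
proof -
  have "A * (B * X) = A * B * X"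
    using assms by (intro assoc_mult_mat_dim[symmetric]) auto
  thus ?thesis using assms by (auto intro!: left_mult_one_mat')
qed

text \<open>Sylvester's determinant identity. The block matrix with rows \<open>(1, -A)\<close> and \<open>(B, 1)\<close> is
  multiplied from the right and from the left by the unipotent block matrix with corner \<open>A\<close>; both
  products are block triangular.\<close>

lemma det_one_plus_mult_commute:
  fixes A B :: "'a :: idom mat"
  assumes A: "A \<in> carrier_mat n m" and B: "B \<in> carrier_mat m n"
  shows "det (1\<^sub>m n + A * B) = det (1\<^sub>m m + B * A)"
proof -
  let ?M = "four_block_mat (1\<^sub>m n) (- A) B (1\<^sub>m m)"
  let ?U = "four_block_mat (1\<^sub>m n) A (0\<^sub>m m n) (1\<^sub>m m)"
  have M: "?M \<in> carrier_mat (n + m) (n + m)" and U: "?U \<in> carrier_mat (n + m) (n + m)"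
    using A B by auto
  have "det ?M * det ?U = det (?M * ?U)" using det_mult[OF M U] by simp
  also have "?M * ?U = four_block_mat (1\<^sub>m n) (0\<^sub>m n m) B (1\<^sub>m m + B * A)"
    using A B by (subst mult_four_block_mat[of _ n n _ m _ m _ _ n _ m])
       (auto intro!: cong_four_block_mat comm_add_mat)
  also have "det \<dots> = det (1\<^sub>m m + B * A)"
    using A B by (subst det_four_block_mat_upper_right_zero[of _ n _ m]) auto
  finally have 1: "det ?M * det ?U = det (1\<^sub>m m + B * A)" .
  have "det ?U * det ?M = det (?U * ?M)" using det_mult[OF U M] by simp
  also have "?U * ?M = four_block_mat (1\<^sub>m n + A * B) (0\<^sub>m n m) B (1\<^sub>m m)"
    using A B by (subst mult_four_block_mat[of _ n n _ m _ m _ _ n _ m])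
       (auto intro!: cong_four_block_mat)
  also have "det \<dots> = det (1\<^sub>m n + A * B)"
    using A B by (subst det_four_block_mat_upper_right_zero[of _ n _ m]) auto
  finally show ?thesis using 1 by (simp add: mult.commute)
qed

lemma mat_inv_facts:
  assumes A: "A \<in> carrier_mat n n" and inv: "invertible_mat A"
  shows "A * mat_inv A = 1\<^sub>m n" and "mat_inv A * A = 1\<^sub>m n" and "mat_inv A \<in> carrier_mat n n"
proof -
  from inv obtain B where B: "inverts_mat A B" "inverts_mat B A"
    unfolding invertible_mat_def by auto
  have "A * B = 1\<^sub>m n" using B A unfolding inverts_mat_def by auto
  moreover have BA: "B * A = 1\<^sub>m (dim_row B)" using B unfolding inverts_mat_def by auto
  moreover have "dim_row B = n" using BA A by (metis carrier_matD(2) index_mult_mat(3) index_one_mat(3))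
  moreover have "dim_col B = n" using calculation(1) by (metis index_mult_mat(3) index_one_mat(3))
  ultimately have "A \<in> Units (ring_mat TYPE(real) n ())"
    using A unfolding Units_def by (auto simp: ring_mat_simps intro!: bexI[of _ B])
  with mat_inverse(1)[OF A, where b = "()"] obtain C where C: "mat_inverse A = Some C"
    by (cases "mat_inverse A") auto
  from mat_inverse(2)[OF A C] C
  show "A * mat_inv A = 1\<^sub>m n" "mat_inv A * A = 1\<^sub>m n" "mat_inv A \<in> carrier_mat n n"
    by (auto simp: mat_inv_def)
qed

lemma mat_inv_symmetric:
  assumes A: "A \<in> carrier_mat n n" and inv: "invertible_mat A" and sym: "A\<^sup>T = A"
  shows "(mat_inv A)\<^sup>T = mat_inv A"
proof -
  note I = mat_inv_facts[OF A inv]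
  have "(mat_inv A)\<^sup>T = (mat_inv A)\<^sup>T * (A * mat_inv A)" using I by simp
  also have "\<dots> = (A * mat_inv A)\<^sup>T * mat_inv A"
    using A I(3) sym by (subst transpose_mult_dim) (auto simp: assoc_mult_mat_dim)
  also have "\<dots> = mat_inv A" using I by simp
  finally show ?thesis .
qed

lemma sum_diag_mult_commute:
  fixes A B :: "'a :: comm_semiring_0 mat"
  assumes "A \<in> carrier_mat n m" and "B \<in> carrier_mat m n"
  shows "(\<Sum>i<n. (A * B) $$ (i, i)) = (\<Sum>j<m. (B * A) $$ (j, j))"
proof -
  have "(\<Sum>i<n. (A * B) $$ (i, i)) = (\<Sum>i<n. \<Sum>j<m. A $$ (i, j) * B $$ (j, i))"
    using assms by (auto simp: scalar_prod_def atLeast0LessThan intro!: sum.cong)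
  also have "\<dots> = (\<Sum>j<m. \<Sum>i<n. B $$ (j, i) * A $$ (i, j))"
    by (subst sum.swap) (simp add: mult.commute)
  also have "\<dots> = (\<Sum>j<m. (B * A) $$ (j, j))"
    using assms by (auto simp: scalar_prod_def atLeast0LessThan intro!: sum.cong)
  finally show ?thesis .
qed

lemma mult_mat_zero_vec:
  fixes A :: "'a :: semiring_1 mat"
  assumes "A \<in> carrier_mat n m"
  shows "A *\<^sub>v 0\<^sub>v m = 0\<^sub>v n"
  using assms by (intro eq_vecI) auto

lemma mult_mat_unit_vec:
  fixes A :: "'a :: semiring_1 mat"
  assumes "A \<in> carrier_mat n m" and "j < m"
  shows "A *\<^sub>v unit_vec m j = col A j"
  using assms by (intro eq_vecI) auto

lemma real_scalar_prod_self:
  fixes x :: "real vec"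
  assumes "x \<in> carrier_vec n"
  shows "0 \<le> x \<bullet> x" and "x \<bullet> x = 0 \<longleftrightarrow> x = 0\<^sub>v n"
  using conjugate_square_ge_0_vec[of x] conjugate_square_eq_0_vec[OF assms] by auto

section \<open>Positive definite matrices\<close>

lemma scalar_prod_mult_mat_vec:
  fixes A :: "real mat"
  assumes "A \<in> carrier_mat n m" "x \<in> carrier_vec m" "y \<in> carrier_vec n"
  shows "(A *\<^sub>v x) \<bullet> y = x \<bullet> (A\<^sup>T *\<^sub>v y)"
  using assms
  by (metis transpose_carrier_mat transpose_vec_mult_scalar transpose_transpose)

lemma quadratic_form_congruence:
  fixes A B :: "real mat"
  assumes A: "A \<in> carrier_mat n n" and B: "B \<in> carrier_mat n m" and x: "x \<in> carrier_vec m"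
  shows "x \<bullet> (B\<^sup>T * A * B *\<^sub>v x) = (B *\<^sub>v x) \<bullet> (A *\<^sub>v (B *\<^sub>v x))"
proof -
  have "B\<^sup>T * A * B *\<^sub>v x = B\<^sup>T *\<^sub>v (A *\<^sub>v (B *\<^sub>v x))"
    using A B x
    by (simp add: assoc_mult_mat_vec[of _ m n _ m] assoc_mult_mat_vec[of _ m n _ n])
  thus ?thesis using scalar_prod_mult_mat_vec[OF B x, of "A *\<^sub>v (B *\<^sub>v x)"] A B x by auto
qed

lemma symmetric_congruence:
  fixes A B :: "real mat"
  assumes A: "A \<in> carrier_mat n n" and B: "B \<in> carrier_mat n m" and "A\<^sup>T = A"
  shows "(B\<^sup>T * A * B)\<^sup>T = B\<^sup>T * A * B"
  using assms by (simp add: transpose_mult_dim assoc_mult_mat_dim)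

lemma pos_semidef_congruence:
  assumes A: "A \<in> carrier_mat n n" "pos_semidef_mat A" and B: "B \<in> carrier_mat n m"
  shows "pos_semidef_mat (B\<^sup>T * A * B)"
proof -
  have "0 \<le> x \<bullet> (B\<^sup>T * A * B *\<^sub>v x)" if x: "x \<in> carrier_vec m" for x
    unfolding quadratic_form_congruence[OF A(1) B x]
    using A B x unfolding pos_semidef_mat_def by auto
  moreover have "(B\<^sup>T * A * B)\<^sup>T = B\<^sup>T * A * B"
    using A B by (intro symmetric_congruence) (auto simp: pos_semidef_mat_def)
  ultimately show ?thesis using A B unfolding pos_semidef_mat_def by auto
qed

lemma pos_def_congruence:
  assumes A: "A \<in> carrier_mat n n" "pos_def_mat A" and B: "B \<in> carrier_mat n m"
    and left_inv: "C \<in> carrier_mat m n" "C * B = 1\<^sub>m m"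
  shows "pos_def_mat (B\<^sup>T * A * B)"
proof -
  have "0 < x \<bullet> (B\<^sup>T * A * B *\<^sub>v x)" if x: "x \<in> carrier_vec m" "x \<noteq> 0\<^sub>v m" for x
  proof -
    have "C *\<^sub>v (B *\<^sub>v x) = x"
      using assoc_mult_mat_vec[OF left_inv(1) B x(1)] left_inv(2) x by simp
    hence "B *\<^sub>v x \<noteq> 0\<^sub>v n" using x mult_mat_zero_vec[OF left_inv(1)] by auto
    thus ?thesis
      unfolding quadratic_form_congruence[OF A(1) B x(1)]
      using A B x unfolding pos_def_mat_def by auto
  qed
  moreover have "(B\<^sup>T * A * B)\<^sup>T = B\<^sup>T * A * B"
    using A B by (intro symmetric_congruence) (auto simp: pos_def_mat_def)
  ultimately show ?thesis using A B unfolding pos_def_mat_def by auto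
qed

lemma pos_def_imp_pos_semidef:
  assumes "pos_def_mat A"
  shows "pos_semidef_mat A"
proof -
  have "0 \<le> x \<bullet> (A *\<^sub>v x)" if "x \<in> carrier_vec (dim_row A)" for x
  proof (cases "x = 0\<^sub>v (dim_row A)")
    case True
    have "A \<in> carrier_mat (dim_row A) (dim_row A)" using assms unfolding pos_def_mat_def by auto
    from mult_mat_zero_vec[OF this] show ?thesis unfolding True by simp
  next
    case False
    thus ?thesis using assms that unfolding pos_def_mat_def by (auto intro: less_imp_le)
  qed
  thus ?thesis using assms unfolding pos_def_mat_def pos_semidef_mat_def by auto
qed

lemma pos_def_add_pos_semidef:
  assumes A: "A \<in> carrier_mat n n" "pos_def_mat A" and B: "B \<in> carrier_mat n n" "pos_semidef_mat B"
  shows "pos_def_mat (A + B)"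
proof -
  have "0 < x \<bullet> ((A + B) *\<^sub>v x)" if x: "x \<in> carrier_vec n" "x \<noteq> 0\<^sub>v n" for x
  proof -
    have "x \<bullet> ((A + B) *\<^sub>v x) = x \<bullet> (A *\<^sub>v x) + x \<bullet> (B *\<^sub>v x)"
      using A B x by (simp add: add_mult_distrib_mat_vec[of _ n n] scalar_prod_add_distrib[of _ n])
    moreover have "0 < x \<bullet> (A *\<^sub>v x)" "0 \<le> x \<bullet> (B *\<^sub>v x)"
      using A B x unfolding pos_def_mat_def pos_semidef_mat_def by auto
    ultimately show ?thesis by simp
  qed
  thus ?thesis using A B unfolding pos_def_mat_def pos_semidef_mat_def
    by (auto simp: transpose_add[of _ n n])
qed

lemma pos_def_imp_invertible:
  assumes A: "A \<in> carrier_mat n n" and pd: "pos_def_mat A"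
  shows "invertible_mat A"
proof -
  have "det A \<noteq> 0"
  proof
    assume "det A = 0"
    then obtain x where x: "x \<in> carrier_vec n" "x \<noteq> 0\<^sub>v n" "A *\<^sub>v x = 0\<^sub>v n"
      using det_0_iff_vec_prod_zero[OF A] by auto
    have "0 < x \<bullet> (A *\<^sub>v x)" using pd A x unfolding pos_def_mat_def by auto
    thus False using x by simp
  qed
  from det_non_zero_imp_unit[OF A this, of "()"]
  obtain B where "B \<in> carrier_mat n n" "A * B = 1\<^sub>m n" "B * A = 1\<^sub>m n"
    unfolding Units_def by (auto simp: ring_mat_simps)
  thus ?thesis using A unfolding invertible_mat_def inverts_mat_def by auto
qed

lemma pos_def_mat_inv:
  assumes A: "A \<in> carrier_mat n n" and pd: "pos_def_mat A"
  shows "pos_def_mat (mat_inv A)"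
proof -
  note inv = pos_def_imp_invertible[OF A pd]
  note I = mat_inv_facts[OF A inv]
  have "(mat_inv A)\<^sup>T = mat_inv A"
    using mat_inv_symmetric[OF A inv] pd unfolding pos_def_mat_def by auto
  hence "(mat_inv A)\<^sup>T * A * mat_inv A = mat_inv A" using I by simp
  thus ?thesis using pos_def_congruence[OF A pd I(3) A I(1)] by simp
qed

text \<open>A zero of the quadratic form of a semidefinite matrix is a minimum of it, so the gradient
  vanishes there; the step length below exhibits a negative value otherwise.\<close>

lemma pos_semidef_quadratic_form_zero:
  assumes A: "A \<in> carrier_mat n n" "pos_semidef_mat A" and x: "x \<in> carrier_vec n"
    and zero: "x \<bullet> (A *\<^sub>v x) = 0"
  shows "A *\<^sub>v x = 0\<^sub>v n"
proof -
  define y where "y = A *\<^sub>v x"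
  define c where "c = y \<bullet> (A *\<^sub>v y)"
  have y: "y \<in> carrier_vec n" unfolding y_def using A x by auto
  have sym: "A\<^sup>T = A" using A unfolding pos_semidef_mat_def by auto
  have quad: "0 \<le> 2 * t * (y \<bullet> y) + t\<^sup>2 * c" for t
  proof -
    have Ay: "A *\<^sub>v y \<in> carrier_vec n" using A y by auto
    have "0 \<le> (x + t \<cdot>\<^sub>v y) \<bullet> (A *\<^sub>v (x + t \<cdot>\<^sub>v y))"
      using A x y unfolding pos_semidef_mat_def by auto
    also have "A *\<^sub>v (x + t \<cdot>\<^sub>v y) = y + t \<cdot>\<^sub>v (A *\<^sub>v y)"
      using A x y by (simp add: mult_add_distrib_mat_vec[of _ n n] mult_mat_vec[of _ n n] y_def)
    also have "(x + t \<cdot>\<^sub>v y) \<bullet> \<dots> = x \<bullet> y + t * (x \<bullet> (A *\<^sub>v y)) + t * (y \<bullet> y) + t * t * c"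
      using x y Ay by (simp add: add_scalar_prod_distrib[of _ n] scalar_prod_add_distrib[of _ n]
          c_def algebra_simps)
    also have "x \<bullet> (A *\<^sub>v y) = y \<bullet> y"
      using scalar_prod_mult_mat_vec[OF A(1) x y] sym by (simp add: y_def)
    finally show ?thesis using zero by (simp add: y_def power2_eq_square algebra_simps)
  qed
  have c0: "0 \<le> c" using A y unfolding c_def pos_semidef_mat_def by auto
  have yy: "0 \<le> y \<bullet> y" by (rule real_scalar_prod_self(1)[OF y])
  have "y \<bullet> y = 0"
  proof (rule ccontr)
    assume "y \<bullet> y \<noteq> 0"
    with yy have pos: "0 < y \<bullet> y" by simp
    let ?t = "- (y \<bullet> y) / (1 + c)"
    have "2 * (- q / s) * q + (- q / s)\<^sup>2 * c = q\<^sup>2 / s\<^sup>2 * (c - 2 * s)" if "s \<noteq> 0" for q s :: real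
      using that by (simp add: field_simps power2_eq_square)
    from this[of "1 + c" "y \<bullet> y"] c0
    have "2 * ?t * (y \<bullet> y) + ?t\<^sup>2 * c = (y \<bullet> y)\<^sup>2 / (1 + c)\<^sup>2 * (c - 2 * (1 + c))" by simp
    also have "\<dots> < 0" using c0 pos by (intro mult_pos_neg) auto
    finally show False using quad[of ?t] by simp
  qed
  thus ?thesis using real_scalar_prod_self(2)[OF y] unfolding y_def by simp
qed

lemma pos_semidef_invertible_imp_pos_def:
  assumes A: "A \<in> carrier_mat n n" and psd: "pos_semidef_mat A"
    and inv: "C \<in> carrier_mat n n" "C * A = 1\<^sub>m n"
  shows "pos_def_mat A"
proof -
  have "0 < x \<bullet> (A *\<^sub>v x)" if x: "x \<in> carrier_vec n" "x \<noteq> 0\<^sub>v n" for x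
  proof -
    have "x \<bullet> (A *\<^sub>v x) \<noteq> 0"
    proof
      assume "x \<bullet> (A *\<^sub>v x) = 0"
      from pos_semidef_quadratic_form_zero[OF A psd x(1) this]
      have "C *\<^sub>v (A *\<^sub>v x) = 0\<^sub>v n" using mult_mat_zero_vec[OF inv(1)] by simp
      thus False using assoc_mult_mat_vec[OF inv(1) A x(1)] inv x by simp
    qed
    moreover have "0 \<le> x \<bullet> (A *\<^sub>v x)" using psd A x unfolding pos_semidef_mat_def by auto
    ultimately show ?thesis by simp
  qed
  thus ?thesis using A psd unfolding pos_def_mat_def pos_semidef_mat_def by auto
qed

section \<open>Deflation\<close>

text \<open>The block diagonal matrix with the scalar \<open>a\<close> in the corner and \<open>S\<close> below it.\<close>

definition diag_cons :: "real \<Rightarrow> real mat \<Rightarrow> real mat" where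
  "diag_cons a S = four_block_mat (mat 1 1 (\<lambda>_. a)) (0\<^sub>m 1 (dim_col S)) (0\<^sub>m (dim_row S) 1) S"

lemma diag_cons_carrier [simp]:
  "S \<in> carrier_mat n m \<Longrightarrow> diag_cons a S \<in> carrier_mat (Suc n) (Suc m)"
  unfolding diag_cons_def by auto

lemma diag_cons_mult:
  assumes "S \<in> carrier_mat n n" "T \<in> carrier_mat n n"
  shows "diag_cons a S * diag_cons b T = diag_cons (a * b) (S * T)"
  using assms unfolding diag_cons_def
  by (subst mult_four_block_mat[of _ 1 1 _ n _ n _ _ 1 _ n])
     (auto intro!: cong_four_block_mat simp: scalar_prod_def)

lemma diag_cons_transpose:
  assumes "S \<in> carrier_mat n n"
  shows "(diag_cons a S)\<^sup>T = diag_cons a (S\<^sup>T)"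
  using assms unfolding diag_cons_def
  by (subst transpose_four_block_mat[of _ 1 1 _ n _ n]) (auto intro!: cong_four_block_mat)

lemma diag_cons_quadratic_form:
  assumes S: "S \<in> carrier_mat n n" and x: "x \<in> carrier_vec 1" and y: "y \<in> carrier_vec n"
  shows "(x @\<^sub>v y) \<bullet> (diag_cons a S *\<^sub>v (x @\<^sub>v y)) = a * (x $ 0)\<^sup>2 + y \<bullet> (S *\<^sub>v y)"
proof -
  have "diag_cons a S *\<^sub>v (x @\<^sub>v y) = (mat 1 1 (\<lambda>_. a) *\<^sub>v x) @\<^sub>v (S *\<^sub>v y)"
    unfolding diag_cons_def using mult_mat_vec_split[of "mat 1 1 (\<lambda>_. a)" 1 S n x y] S x y by auto
  also have "(x @\<^sub>v y) \<bullet> \<dots> = x \<bullet> (mat 1 1 (\<lambda>_. a) *\<^sub>v x) + y \<bullet> (S *\<^sub>v y)"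
    using S x y mult_mat_vec_carrier[of "mat 1 1 (\<lambda>_. a)" 1 1 x]
    by (intro scalar_prod_append[of _ 1 _ n]) auto
  also have "x \<bullet> (mat 1 1 (\<lambda>_. a) *\<^sub>v x) = a * (x $ 0)\<^sup>2"
    using x by (simp add: scalar_prod_def power2_eq_square)
  finally show ?thesis .
qed

lemma diag_cons_pos_semidef:
  assumes S: "S \<in> carrier_mat n n" and "pos_semidef_mat S" and "0 \<le> a"
  shows "pos_semidef_mat (diag_cons a S)"
proof -
  have "0 \<le> z \<bullet> (diag_cons a S *\<^sub>v z)" if "z \<in> carrier_vec (Suc n)" for z
  proof -
    have z: "z = vec_first z 1 @\<^sub>v vec_last z n" using that by simp
    show ?thesis
      by (subst (1 2) z, subst diag_cons_quadratic_form[OF S])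
         (use assms in \<open>auto simp: pos_semidef_mat_def\<close>)
  qed
  moreover have "(diag_cons a S)\<^sup>T = diag_cons a S"
    using assms diag_cons_transpose[OF S] unfolding pos_semidef_mat_def by simp
  moreover have "dim_row (diag_cons a S) = Suc n" "dim_col (diag_cons a S) = Suc n"
    using diag_cons_carrier[OF S, of a] by auto
  ultimately show ?thesis unfolding pos_semidef_mat_def by auto
qed

lemma diag_cons_pos_defD:
  assumes S: "S \<in> carrier_mat n n" and pd: "pos_def_mat (diag_cons a S)"
  shows "0 < a" and "pos_def_mat S"
proof -
  have D: "diag_cons a S \<in> carrier_mat (Suc n) (Suc n)" using S by simp
  have pos: "0 < a * (x $ 0)\<^sup>2 + y \<bullet> (S *\<^sub>v y)"
    if "x \<in> carrier_vec 1" "y \<in> carrier_vec n" "x \<noteq> 0\<^sub>v 1 \<or> y \<noteq> 0\<^sub>v n" for x y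
  proof -
    have "x @\<^sub>v y \<noteq> 0\<^sub>v 1 @\<^sub>v 0\<^sub>v n" using that by (subst append_vec_eq[of _ 1]) auto
    moreover have "0\<^sub>v 1 @\<^sub>v 0\<^sub>v n = (0\<^sub>v (Suc n) :: real vec)" by (intro eq_vecI) auto
    moreover have "x @\<^sub>v y \<in> carrier_vec (Suc n)" using append_carrier_vec[OF that(1,2)] by simp
    ultimately show ?thesis using pd D diag_cons_quadratic_form[OF S that(1,2), of a]
      unfolding pos_def_mat_def by auto
  qed
  show "0 < a" using pos[of "unit_vec 1 0" "0\<^sub>v n"] S by (simp add: mult_mat_zero_vec[OF S])
  have "(diag_cons a S)\<^sup>T = diag_cons a S" using pd unfolding pos_def_mat_def by auto
  hence "diag_cons a (S\<^sup>T) = diag_cons a S" using diag_cons_transpose[OF S] by simp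
  have "S\<^sup>T = S"
  proof (intro eq_matI)
    fix i j assume ij: "i < dim_row S" "j < dim_col S"
    have "diag_cons a (S\<^sup>T) $$ (Suc i, Suc j) = diag_cons a S $$ (Suc i, Suc j)"
      using \<open>diag_cons a (S\<^sup>T) = diag_cons a S\<close> by simp
    thus "S\<^sup>T $$ (i, j) = S $$ (i, j)" using ij S unfolding diag_cons_def by auto
  qed (use S in auto)
  moreover have "0 < y \<bullet> (S *\<^sub>v y)" if "y \<in> carrier_vec n" "y \<noteq> 0\<^sub>v n" for y
    using pos[of "0\<^sub>v 1" y] that by simp
  ultimately show "pos_def_mat S" using S unfolding pos_def_mat_def by auto
qed

lemma symmetric_eq_diag_cons:
  assumes B: "B \<in> carrier_mat (Suc n) (Suc n)" and sym: "B\<^sup>T = B"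
    and ev: "B *\<^sub>v unit_vec (Suc n) 0 = a \<cdot>\<^sub>v unit_vec (Suc n) 0"
  shows "B = diag_cons a (mat n n (\<lambda>(i, j). B $$ (Suc i, Suc j)))"
proof -
  have col0: "B $$ (i, 0) = (if i = 0 then a else 0)" if "i < Suc n" for i
  proof -
    have "B $$ (i, 0) = (B *\<^sub>v unit_vec (Suc n) 0) $ i"
      using that B by (simp add: mult_mat_unit_vec[OF B] del: index_mult_mat_vec)
    thus ?thesis unfolding ev using that by simp
  qed
  have row0: "B $$ (0, j) = (if j = 0 then a else 0)" if "j < Suc n" for j
    using col0[OF that] arg_cong[OF sym, of "\<lambda>M. M $$ (0, j)"] that B by auto
  show ?thesis
    by (rule eq_matI) (use B col0 row0 in \<open>auto simp: diag_cons_def\<close>)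
qed

text \<open>The common induction step of the Cholesky factorization and of the square root: a congruence
  after which the first unit vector is an eigenvector splits off the first coordinate, and the
  remaining block is again positive definite.\<close>

lemma pos_def_deflate:
  assumes A: "A \<in> carrier_mat (Suc n) (Suc n)" "pos_def_mat A"
    and T: "T \<in> carrier_mat (Suc n) (Suc n)" and U: "U \<in> carrier_mat (Suc n) (Suc n)"
    and inv: "T * U = 1\<^sub>m (Suc n)" "U * T = 1\<^sub>m (Suc n)"
    and ev: "(U * A * U\<^sup>T) *\<^sub>v unit_vec (Suc n) 0 = a \<cdot>\<^sub>v unit_vec (Suc n) 0"
  obtains S where "S \<in> carrier_mat n n" "pos_def_mat S" "0 < a" "A = T * diag_cons a S * T\<^sup>T"
proof -
  let ?B = "U * A * U\<^sup>T"
  define S where "S = mat n n (\<lambda>(i, j). ?B $$ (Suc i, Suc j))"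
  have B: "?B \<in> carrier_mat (Suc n) (Suc n)" using A U by auto
  have inv': "T\<^sup>T * U\<^sup>T = 1\<^sub>m (Suc n)" "U\<^sup>T * T\<^sup>T = 1\<^sub>m (Suc n)"
    using inv T U by (simp_all add: transpose_mult_dim[symmetric])
  have pd: "pos_def_mat ?B"
    using pos_def_congruence[OF A, of "U\<^sup>T" "Suc n" "T\<^sup>T"] T U inv' by simp
  hence "?B\<^sup>T = ?B" unfolding pos_def_mat_def by auto
  hence BS: "?B = diag_cons a S" unfolding S_def by (intro symmetric_eq_diag_cons[OF B _ ev])
  have S: "S \<in> carrier_mat n n" unfolding S_def by simp
  have "T * ?B * T\<^sup>T = A"
    using A T U inv' by (simp add: assoc_mult_mat_dim mult_cancel_left_mat[OF inv(1)])
  hence "A = T * diag_cons a S * T\<^sup>T" unfolding BS by simp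
  with diag_cons_pos_defD[OF S] pd[unfolded BS] S that show ?thesis by blast
qed

section \<open>Cholesky factorization\<close>

lemma shear_mult:
  fixes v w :: "real mat"
  assumes "v \<in> carrier_mat n 1" and "w \<in> carrier_mat n 1"
  shows "four_block_mat (1\<^sub>m 1) (0\<^sub>m 1 n) v (1\<^sub>m n) * four_block_mat (1\<^sub>m 1) (0\<^sub>m 1 n) w (1\<^sub>m n)
    = four_block_mat (1\<^sub>m 1) (0\<^sub>m 1 n) (v + w) (1\<^sub>m n)"
  using assms
  by (subst mult_four_block_mat[of _ 1 1 _ n _ n _ _ 1 _ n]) (auto intro!: cong_four_block_mat)

lemma cholesky_factor_exists:
  assumes "A \<in> carrier_mat n n" and "pos_def_mat A"
  shows "\<exists>L. is_cholesky_factor A L"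
  using assms
proof (induction n arbitrary: A)
  case 0
  thus ?case by (intro exI[of _ A]) (auto simp: is_cholesky_factor_def)
next
  case (Suc n)
  note A = Suc.prems
  let ?e = "unit_vec (Suc n) 0 :: real vec"
  \<comment> \<open>\<open>w\<close> is the first column of \<open>A\<close> below the pivot \<open>a\<close>, divided by \<open>a\<close>; \<open>U\<close> eliminates it.\<close>
  define a where "a = A $$ (0, 0)"
  define w where "w = mat n 1 (\<lambda>(i, _). A $$ (Suc i, 0) / a)"
  define T where "T = four_block_mat (1\<^sub>m 1) (0\<^sub>m 1 n) w (1\<^sub>m n)"
  define U where "U = four_block_mat (1\<^sub>m 1) (0\<^sub>m 1 n) (- w) (1\<^sub>m n)"
  have w: "w \<in> carrier_mat n 1" unfolding w_def by simp
  have T: "T \<in> carrier_mat (Suc n) (Suc n)" and U: "U \<in> carrier_mat (Suc n) (Suc n)"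
    unfolding T_def U_def using w by auto
  have TU: "T * U = 1\<^sub>m (Suc n)" and UT: "U * T = 1\<^sub>m (Suc n)"
    unfolding T_def U_def using shear_mult[OF w, of "- w"] shear_mult[of "- w" n w] w
      uminus_l_inv_mat[OF w] add_uminus_minus_mat[OF w w] four_block_one_mat[of 1 n]
    by auto
  have "0 < ?e \<bullet> (A *\<^sub>v ?e)"
    using A unfolding pos_def_mat_def
    by (metis carrier_matD(1) unit_vec_carrier unit_vec_nonzero zero_less_Suc)
  moreover have "?e \<bullet> (A *\<^sub>v ?e) = A $$ (0, 0)"
    using A(1) by (subst mult_mat_unit_vec[OF A(1)], simp, subst scalar_prod_left_unit)
      (auto intro!: carrier_vecI)
  ultimately have a: "0 < a" unfolding a_def by simp
  have Ae: "A *\<^sub>v ?e = a \<cdot>\<^sub>v (T *\<^sub>v ?e)"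
    using A T a w by (intro eq_vecI) (auto simp: a_def w_def T_def)
  have Ue: "U\<^sup>T *\<^sub>v ?e = ?e"
    using U w by (intro eq_vecI) (auto simp: U_def)
  have "(U * A * U\<^sup>T) *\<^sub>v ?e = U *\<^sub>v (A *\<^sub>v (U\<^sup>T *\<^sub>v ?e))"
    using U A by (simp add: assoc_mult_mat_vec[of _ "Suc n" "Suc n" _ "Suc n"] assoc_mult_mat_dim)
  also have "\<dots> = a \<cdot>\<^sub>v (U * T *\<^sub>v ?e)"
    unfolding Ue Ae using U T
    by (simp add: mult_mat_vec[of _ "Suc n" "Suc n"] assoc_mult_mat_vec[of _ "Suc n" "Suc n" _ "Suc n"])
  finally have ev: "(U * A * U\<^sup>T) *\<^sub>v ?e = a \<cdot>\<^sub>v ?e" unfolding UT by simp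
  obtain S where S: "S \<in> carrier_mat n n" "pos_def_mat S" and AS: "A = T * diag_cons a S * T\<^sup>T"
    using pos_def_deflate[OF A T U TU UT ev] by blast
  obtain M where M: "is_cholesky_factor S M" using Suc.IH[OF S] by blast
  have Mc: "M \<in> carrier_mat n n" and SM: "S = M * M\<^sup>T"
    using M S unfolding is_cholesky_factor_def by auto
  define L where "L = T * diag_cons (sqrt a) M"
  have L_block: "L = four_block_mat (mat 1 1 (\<lambda>_. sqrt a)) (0\<^sub>m 1 n) (w * mat 1 1 (\<lambda>_. sqrt a)) M"
    unfolding L_def T_def diag_cons_def using w Mc
    by (subst mult_four_block_mat[of _ 1 1 _ n _ n _ _ 1 _ n]) (auto intro!: cong_four_block_mat)
  have D: "diag_cons (sqrt a) M \<in> carrier_mat (Suc n) (Suc n)" using Mc by simp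
  have "L * L\<^sup>T = T * (diag_cons (sqrt a) M * (diag_cons (sqrt a) M)\<^sup>T) * T\<^sup>T"
    using T D unfolding L_def by (simp add: transpose_mult_dim assoc_mult_mat_dim)
  also have "diag_cons (sqrt a) M * (diag_cons (sqrt a) M)\<^sup>T = diag_cons a S"
    using a Mc by (simp add: diag_cons_transpose diag_cons_mult SM)
  finally have "A = L * L\<^sup>T" using AS by simp
  moreover have "L $$ (i, j) = 0" if "i < Suc n" "j < Suc n" "i < j" for i j
    using that M S Mc w unfolding L_block is_cholesky_factor_def by auto
  moreover have "0 < L $$ (i, i)" if "i < Suc n" for i
    using that M S Mc w a unfolding L_block is_cholesky_factor_def by auto
  moreover have "L \<in> carrier_mat (Suc n) (Suc n)" unfolding L_def using T D by auto
  ultimately have "is_cholesky_factor A L" using A unfolding is_cholesky_factor_def by auto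
  thus ?case by blast
qed

section \<open>The positive semidefinite square root\<close>

text \<open>A complex eigenvalue exists; it is real because \<open>A\<close> is Hermitian, hence a root of the real
  characteristic polynomial, which provides a real eigenvector.\<close>

lemma symmetric_real_eigenvector:
  fixes A :: "real mat"
  assumes A: "A \<in> carrier_mat n n" and sym: "A\<^sup>T = A" and n: "0 < n"
  shows "\<exists>x l. x \<in> carrier_vec n \<and> x \<bullet> x = 1 \<and> A *\<^sub>v x = l \<cdot>\<^sub>v x"
proof -
  let ?A = "map_mat complex_of_real A"
  have A': "?A \<in> carrier_mat n n" using A by simp
  from spectrum_non_empty[OF A' n] obtain k where k: "eigenvalue ?A k"
    unfolding spectrum_def by auto
  then obtain v where v: "v \<in> carrier_vec n" "v \<noteq> 0\<^sub>v n" and Av: "?A *\<^sub>v v = k \<cdot>\<^sub>v v"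
    unfolding eigenvalue_def eigenvector_def using A by auto
  have conj: "?A *\<^sub>v conjugate v = conjugate (?A *\<^sub>v v)"
    using A v by (intro eq_vecI) (auto simp: scalar_prod_def)
  have "k * (v \<bullet>c v) = (?A *\<^sub>v v) \<bullet> conjugate v" unfolding Av using v by simp
  also have "\<dots> = v \<bullet> (?A *\<^sub>v conjugate v)"
    using A v sym
    by (subst transpose_vec_mult_scalar[symmetric, of _ n n])
       (auto simp: map_mat_transpose comm_scalar_prod[of _ n])
  also have "\<dots> = cnj k * (v \<bullet>c v)" unfolding conj Av using v by (simp add: conjugate_smult_vec)
  finally have "k = cnj k" using v conjugate_square_eq_0_vec[OF v(1)] by simp
  then obtain l where l: "k = of_real l" by (metis Reals_cnj_iff Reals_cases)
  have "poly (char_poly ?A) k = 0" using k eigenvalue_root_char_poly[OF A'] by blast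
  hence "poly (map_poly of_real (char_poly A)) (complex_of_real l) = 0"
    unfolding of_real_hom.char_poly_hom[OF A] l .
  hence "poly (char_poly A) l = 0" by simp
  hence "eigenvalue A l" using eigenvalue_root_char_poly[OF A] by simp
  then obtain y where y: "y \<in> carrier_vec n" "y \<noteq> 0\<^sub>v n" and Ay: "A *\<^sub>v y = l \<cdot>\<^sub>v y"
    unfolding eigenvalue_def eigenvector_def using A by auto
  define c where "c = inverse (sqrt (y \<bullet> y))"
  have "0 < y \<bullet> y" using real_scalar_prod_self[OF y(1)] y by simp
  hence "c * c * (y \<bullet> y) = 1" unfolding c_def by (simp add: field_simps)
  hence "(c \<cdot>\<^sub>v y) \<bullet> (c \<cdot>\<^sub>v y) = 1" using y by (simp add: mult.assoc)
  moreover have "A *\<^sub>v (c \<cdot>\<^sub>v y) = l \<cdot>\<^sub>v (c \<cdot>\<^sub>v y)"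
    using y A by (simp add: mult_mat_vec[of _ n n] Ay smult_smult_assoc mult.commute)
  ultimately show ?thesis using y by (intro exI[of _ "c \<cdot>\<^sub>v y"] exI[of _ l]) simp
qed

text \<open>The reflection in the hyperplane orthogonal to \<open>u = x - e\<^sub>0\<close>.\<close>

lemma householder_reflection:
  fixes x :: "real vec"
  assumes x: "x \<in> carrier_vec n" and unit: "x \<bullet> x = 1" and n: "0 < n"
  shows "\<exists>H. H \<in> carrier_mat n n \<and> H\<^sup>T = H \<and> H * H = 1\<^sub>m n \<and> H *\<^sub>v unit_vec n 0 = x"
proof -
  define u where "u = x - unit_vec n 0"
  \<comment> \<open>If \<open>x\<close> is the first unit vector, then \<open>c = 2 / 0 = 0\<close> and the reflection is the identity.\<close>
  define c where "c = 2 / (u \<bullet> u)"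
  define H where "H = mat n n (\<lambda>(i, j). (if i = j then 1 else 0) - c * u $ i * u $ j)"
  have u: "u \<in> carrier_vec n" unfolding u_def using x by simp
  have H: "H \<in> carrier_mat n n" unfolding H_def by simp
  have sym: "H\<^sup>T = H" unfolding H_def by (intro eq_matI) auto
  have colH: "col H j = unit_vec n j - (c * u $ j) \<cdot>\<^sub>v u" if "j < n" for j
    using that u unfolding H_def by (intro eq_vecI) auto
  have rowH: "row H j = unit_vec n j - (c * u $ j) \<cdot>\<^sub>v u" if "j < n" for j
    using colH[OF that] sym H that by (metis carrier_matD(2) row_transpose)
  have cuu: "c * (c * (u \<bullet> u)) = 2 * c" unfolding c_def by simp
  have "H * H = 1\<^sub>m n"
  proof (intro eq_matI)
    fix i j assume "i < dim_row (1\<^sub>m n :: real mat)" "j < dim_col (1\<^sub>m n :: real mat)"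
    hence i: "i < n" and j: "j < n" by auto
    have "(H * H) $$ (i, j) = (unit_vec n i - (c * u $ i) \<cdot>\<^sub>v u) \<bullet> (unit_vec n j - (c * u $ j) \<cdot>\<^sub>v u)"
      using i j H by (simp add: colH rowH)
    also have "\<dots> = (if i = j then 1 else 0) - 2 * c * u $ i * u $ j + c * (c * (u \<bullet> u)) * u $ i * u $ j"
      using i j u by (simp add: minus_scalar_prod_distrib[of _ n]
          scalar_prod_minus_distrib[of _ n] algebra_simps)
    finally show "(H * H) $$ (i, j) = 1\<^sub>m n $$ (i, j)" using i j cuu by simp
  qed (use H in auto)
  moreover have "H *\<^sub>v unit_vec n 0 = x"
  proof -
    have "u \<bullet> u = x \<bullet> x - 2 * x $ 0 + 1"
      using n x unfolding u_def
      by (simp add: minus_scalar_prod_distrib[of _ n] scalar_prod_minus_distrib[of _ n])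
    hence uu: "u \<bullet> u = - 2 * u $ 0" using unit n x unfolding u_def by simp
    have "(c * u $ 0) \<cdot>\<^sub>v u = - u"
    proof (cases "u \<bullet> u = 0")
      case True
      hence "u = 0\<^sub>v n" using real_scalar_prod_self[OF u] by simp
      thus ?thesis by auto
    next
      case False
      hence "c * u $ 0 = -1" using uu unfolding c_def by (simp add: field_simps)
      thus ?thesis using u by (intro eq_vecI) auto
    qed
    hence "col H 0 = unit_vec n 0 + u" using colH[OF n] u by (intro eq_vecI) auto
    also have "\<dots> = x" unfolding u_def using x by (intro eq_vecI) auto
    finally show ?thesis using mult_mat_unit_vec[OF H n] by simp
  qed
  ultimately show ?thesis using H sym by blast
qed

lemma sqrt_mat_exists:
  assumes "A \<in> carrier_mat n n" and "pos_def_mat A"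
  shows "\<exists>S. S \<in> carrier_mat n n \<and> pos_semidef_mat S \<and> S * S = A"
  using assms
proof (induction n arbitrary: A)
  case 0
  thus ?case by (intro exI[of _ A]) (auto intro!: pos_def_imp_pos_semidef eq_matI)
next
  case (Suc n)
  note A = Suc.prems
  let ?e = "unit_vec (Suc n) 0 :: real vec"
  have "A\<^sup>T = A" using A unfolding pos_def_mat_def by auto
  then obtain x a where x: "x \<in> carrier_vec (Suc n)" "x \<bullet> x = 1" and Ax: "A *\<^sub>v x = a \<cdot>\<^sub>v x"
    using symmetric_real_eigenvector[OF A(1)] by blast
  obtain H where H: "H \<in> carrier_mat (Suc n) (Suc n)" "H\<^sup>T = H" and HH: "H * H = 1\<^sub>m (Suc n)"
    and He: "H *\<^sub>v ?e = x"
    using householder_reflection[OF x] by blast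
  have "(H * A * H\<^sup>T) *\<^sub>v ?e = H *\<^sub>v (A *\<^sub>v (H *\<^sub>v ?e))"
    using H A by (simp add: assoc_mult_mat_vec[of _ "Suc n" "Suc n" _ "Suc n"] assoc_mult_mat_dim)
  also have "\<dots> = a \<cdot>\<^sub>v (H * H *\<^sub>v ?e)"
    unfolding He Ax using H x
    by (simp add: mult_mat_vec[of _ "Suc n" "Suc n"] assoc_mult_mat_vec[of _ "Suc n" "Suc n" _ "Suc n"] He)
  finally have ev: "(H * A * H\<^sup>T) *\<^sub>v ?e = a \<cdot>\<^sub>v ?e" unfolding HH by simp
  obtain S where S: "S \<in> carrier_mat n n" "pos_def_mat S" and a: "0 < a"
    and AS: "A = H * diag_cons a S * H\<^sup>T"
    using pos_def_deflate[OF A H(1) H(1) HH HH ev] by blast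
  obtain R where R: "R \<in> carrier_mat n n" "pos_semidef_mat R" and RR: "R * R = S"
    using Suc.IH[OF S] by blast
  define D where "D = diag_cons (sqrt a) R"
  have D: "D \<in> carrier_mat (Suc n) (Suc n)" "pos_semidef_mat D"
    unfolding D_def using R a by (auto intro!: diag_cons_pos_semidef)
  have DD: "D * D = diag_cons a S" unfolding D_def using a R RR by (simp add: diag_cons_mult)
  have "pos_semidef_mat (H * D * H)" using pos_semidef_congruence[OF D H(1)] H by simp
  moreover have "(H * D * H) * (H * D * H) = A"
    unfolding AS DD[symmetric] using H D
    by (simp add: assoc_mult_mat_dim mult_cancel_left_mat[OF HH])
  moreover have "H * D * H \<in> carrier_mat (Suc n) (Suc n)" using H D by auto
  ultimately show ?case by blast
qed

text \<open>If \<open>S\<close> and \<open>T\<close> are two square roots and \<open>D = S - T\<close>, then \<open>D S D + D D T = 0\<close>. Taking traces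
  gives a vanishing sum of the nonnegative values of both quadratic forms at the columns of \<open>D\<close>;
  as \<open>S\<close> is invertible, hence definite, these columns are zero.\<close>

lemma sqrt_mat_unique:
  assumes A: "A \<in> carrier_mat n n" "pos_def_mat A"
    and S: "S \<in> carrier_mat n n" "pos_semidef_mat S" "S * S = A"
    and T: "T \<in> carrier_mat n n" "pos_semidef_mat T" "T * T = A"
  shows "S = T"
proof -
  note inv = mat_inv_facts[OF A(1) pos_def_imp_invertible[OF A]]
  \<comment> \<open>\<open>A\<^sup>-\<^sup>1 S\<close> is a left inverse of \<open>S\<close>.\<close>
  have pdS: "pos_def_mat S"
    using inv S by (intro pos_semidef_invertible_imp_pos_def[of S n "mat_inv A * S"])
      (auto simp: assoc_mult_mat_dim)
  define D where "D = S - T"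
  have D: "D \<in> carrier_mat n n" unfolding D_def using S T by auto
  have symD: "D\<^sup>T = D" unfolding D_def using S T
    by (auto simp: pos_semidef_mat_def transpose_minus[of _ n n])
  have cD: "col D i \<in> carrier_vec n" for i using D by auto
  have trace: "(\<Sum>i<n. (D * M * D) $$ (i, i)) = (\<Sum>i<n. col D i \<bullet> (M *\<^sub>v col D i))"
    if M: "M \<in> carrier_mat n n" for M
  proof (intro sum.cong refl)
    fix i assume i: "i \<in> {..<n}"
    have "(D * M * D) $$ (i, i) = unit_vec n i \<bullet> (D\<^sup>T * M * D *\<^sub>v unit_vec n i)"
      using i D M unfolding symD by (subst mult_mat_unit_vec[of _ n]) auto
    also have "\<dots> = col D i \<bullet> (M *\<^sub>v col D i)"
      using i D M by (subst quadratic_form_congruence[of _ n _ n]) (auto simp: mult_mat_unit_vec)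
    finally show "(D * M * D) $$ (i, i) = col D i \<bullet> (M *\<^sub>v col D i)" .
  qed
  have "S * D + D * T = 0\<^sub>m n n"
  proof -
    have "S * D + D * T = (S * S - S * T) + (S * T - T * T)"
      unfolding D_def using S T
      by (simp add: mult_minus_distrib_mat[of _ n n _ n] minus_mult_distrib_mat[of _ n n _ _ n])
    also have "\<dots> = 0\<^sub>m n n" unfolding S(3) T(3) using A S T by (intro eq_matI) auto
    finally show ?thesis .
  qed
  hence "D * (S * D + D * T) = 0\<^sub>m n n" using D by simp
  hence zero: "D * S * D + D * D * T = 0\<^sub>m n n"
    using D S T by (simp add: mult_add_distrib_mat[of _ n n _ n] assoc_mult_mat_dim)
  have "D * D * T = D * (D * T)" using D T by (simp add: assoc_mult_mat_dim)
  hence comm: "(\<Sum>i<n. (D * D * T) $$ (i, i)) = (\<Sum>i<n. (D * T * D) $$ (i, i))"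
    using sum_diag_mult_commute[of D n n "D * T"] D T by simp
  have "(\<Sum>i<n. (D * S * D) $$ (i, i)) + (\<Sum>i<n. (D * D * T) $$ (i, i))
      = (\<Sum>i<n. (D * S * D + D * D * T) $$ (i, i))"
    using D S T by (simp add: sum.distrib)
  also have "\<dots> = 0" unfolding zero by simp
  finally have sum0: "(\<Sum>i<n. col D i \<bullet> (S *\<^sub>v col D i)) + (\<Sum>i<n. col D i \<bullet> (T *\<^sub>v col D i)) = 0"
    unfolding comm trace[OF S(1)] trace[OF T(1)] .
  have nonneg: "0 \<le> col D i \<bullet> (S *\<^sub>v col D i)" "0 \<le> col D i \<bullet> (T *\<^sub>v col D i)" for i
    using S T cD unfolding pos_semidef_mat_def by auto
  have "(\<Sum>i<n. col D i \<bullet> (S *\<^sub>v col D i)) = 0"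
    using sum0 nonneg sum_nonneg[of "{..<n}" "\<lambda>i. col D i \<bullet> (S *\<^sub>v col D i)"]
      sum_nonneg[of "{..<n}" "\<lambda>i. col D i \<bullet> (T *\<^sub>v col D i)"] by simp
  hence "col D i \<bullet> (S *\<^sub>v col D i) = 0" if "i < n" for i
    using nonneg that by (subst (asm) sum_nonneg_eq_0_iff) auto
  hence col0: "col D i = 0\<^sub>v n" if "i < n" for i
    using that pdS S(1) cD[of i] unfolding pos_def_mat_def by force
  show "S = T"
  proof (intro eq_matI)
    fix i j assume "i < dim_row T" "j < dim_col T"
    hence ij: "i < n" "j < n" using T by auto
    have "D $$ (i, j) = col D j $ i" using ij D by simp
    thus "S $$ (i, j) = T $$ (i, j)" using col0[OF ij(2)] ij S T unfolding D_def by simp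
  qed (use S T in auto)
qed

lemma mat_sqrt_facts:
  assumes A: "A \<in> carrier_mat n n" "pos_def_mat A"
  shows "mat_sqrt A \<in> carrier_mat n n" and "(mat_sqrt A)\<^sup>T = mat_sqrt A"
    and "mat_sqrt A * mat_sqrt A = A"
proof -
  have "\<exists>!S. S \<in> carrier_mat (dim_row A) (dim_row A) \<and> pos_semidef_mat S \<and> S * S = A"
    using sqrt_mat_exists[OF A] sqrt_mat_unique[OF A] A by auto
  note sqrt = theI'[OF this, folded mat_sqrt_def]
  show "mat_sqrt A \<in> carrier_mat n n" "(mat_sqrt A)\<^sup>T = mat_sqrt A" "mat_sqrt A * mat_sqrt A = A"
    using sqrt A unfolding pos_semidef_mat_def by auto
qed

section \<open>The covariance matrices\<close>

lemma Sigma_pr_pos_def: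
  assumes \<Gamma>: "\<Gamma> \<in> carrier_mat m m" "pos_def_mat \<Gamma>" and P: "P \<in> carrier_mat k m"
    and inv: "invertible_mat (Sigma_pr P \<Gamma>)"
  shows "pos_def_mat (Sigma_pr P \<Gamma>)"
proof -
  have \<Sigma>: "Sigma_pr P \<Gamma> \<in> carrier_mat k k" unfolding Sigma_pr_def using P \<Gamma> by auto
  have "pos_semidef_mat (Sigma_pr P \<Gamma>)"
    using pos_semidef_congruence[OF \<Gamma>(1) pos_def_imp_pos_semidef[OF \<Gamma>(2)], of "P\<^sup>T" k] P
    unfolding Sigma_pr_def by simp
  thus ?thesis
    using mat_inv_facts[OF \<Sigma> inv] by (intro pos_semidef_invertible_imp_pos_def[OF \<Sigma>]) auto
qed

text \<open>With \<open>C = P\<^sup>T \<Sigma>\<^sup>-\<^sup>1 P \<Gamma>\<close> the matrix is \<open>(1 - C)\<^sup>T \<Gamma> (1 - C)\<close>. It is the covariance of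
  the parameter conditioned on the quantity of interest.\<close>

lemma conditional_covariance_pos_semidef:
  assumes \<Gamma>: "\<Gamma> \<in> carrier_mat m m" "pos_def_mat \<Gamma>" and P: "P \<in> carrier_mat k m"
    and inv: "invertible_mat (Sigma_pr P \<Gamma>)"
  shows "pos_semidef_mat (\<Gamma> - \<Gamma> * P\<^sup>T * mat_inv (Sigma_pr P \<Gamma>) * P * \<Gamma>)"
proof -
  let ?\<Sigma> = "Sigma_pr P \<Gamma>"
  have \<Sigma>: "?\<Sigma> \<in> carrier_mat k k" unfolding Sigma_pr_def using P \<Gamma> by auto
  have sym: "\<Gamma>\<^sup>T = \<Gamma>" "?\<Sigma>\<^sup>T = ?\<Sigma>"
    using \<Gamma> Sigma_pr_pos_def[OF \<Gamma> P inv] unfolding pos_def_mat_def by auto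
  note I = mat_inv_facts[OF \<Sigma> inv]
  define J where "J = mat_inv ?\<Sigma>"
  have J: "J \<in> carrier_mat k k" and J\<Sigma>: "J * ?\<Sigma> = 1\<^sub>m k" and symJ: "J\<^sup>T = J"
    unfolding J_def using I mat_inv_symmetric[OF \<Sigma> inv sym(2)] by auto
  define C where "C = P\<^sup>T * J * P * \<Gamma>"
  define M where "M = \<Gamma> * P\<^sup>T * J * P * \<Gamma>"
  have C: "C \<in> carrier_mat m m" and M: "M \<in> carrier_mat m m"
    unfolding C_def M_def using P \<Gamma> J by auto
  have \<Gamma>C: "\<Gamma> * C = M" and CT: "C\<^sup>T = \<Gamma> * P\<^sup>T * J * P" and CT\<Gamma>: "C\<^sup>T * \<Gamma> = M"
    unfolding C_def M_def using P \<Gamma> J sym symJ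
    by (simp_all add: assoc_mult_mat_dim transpose_mult_dim)
  have "C\<^sup>T * \<Gamma> * C = \<Gamma> * P\<^sup>T * (J * (?\<Sigma> * (J * (P * \<Gamma>))))"
    unfolding CT unfolding C_def Sigma_pr_def using P \<Gamma> J by (simp add: assoc_mult_mat_dim)
  also have "\<dots> = M"
    unfolding M_def using P \<Gamma> J \<Sigma>
    by (subst mult_cancel_left_mat[OF J\<Sigma>]) (auto simp: assoc_mult_mat_dim)
  finally have C\<Gamma>C: "C\<^sup>T * \<Gamma> * C = M" .
  have "(1\<^sub>m m - C)\<^sup>T * \<Gamma> * (1\<^sub>m m - C) = (\<Gamma> - M) * (1\<^sub>m m - C)"
    using C \<Gamma> CT\<Gamma> by (simp add: transpose_minus[of _ m m] minus_mult_distrib_mat[of _ m m _ _ m])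
  also have "\<dots> = (\<Gamma> - M) - (\<Gamma> * C - C\<^sup>T * \<Gamma> * C)"
    using \<Gamma> M C CT\<Gamma> minus_carrier_mat[OF M, of \<Gamma>]
    by (simp add: mult_minus_distrib_mat[OF minus_carrier_mat[OF M] one_carrier_mat C]
        minus_mult_distrib_mat[OF \<Gamma>(1) M C])
  also have "\<dots> = \<Gamma> - M" unfolding \<Gamma>C C\<Gamma>C using M \<Gamma> by (intro eq_matI) auto
  finally have "(1\<^sub>m m - C)\<^sup>T * \<Gamma> * (1\<^sub>m m - C) = \<Gamma> - M" .
  moreover have "1\<^sub>m m - C \<in> carrier_mat m m" using C by (simp add: minus_carrier_mat)
  ultimately show ?thesis
    using pos_semidef_congruence[OF \<Gamma>(1) pos_def_imp_pos_semidef[OF \<Gamma>(2)]]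
    unfolding M_def J_def by metis
qed

text \<open>Each row of a design is a standard unit vector; two rows are never equal, since no
  column sum exceeds 1.\<close>

lemma design_mult_transpose:
  assumes "W \<in> designs r d"
  shows "W * W\<^sup>T = 1\<^sub>m r"
proof (rule eq_matI)
  have W: "W \<in> carrier_mat r d" and bool: "\<And>i j. i < r \<Longrightarrow> j < d \<Longrightarrow> W $$ (i, j) \<in> {0, 1}"
    and row: "\<And>i. i < r \<Longrightarrow> (\<Sum>j<d. W $$ (i, j)) = 1"
    and col: "\<And>j. j < d \<Longrightarrow> (\<Sum>i<r. W $$ (i, j)) \<in> {0, 1}"
    using assms unfolding designs_def by auto
  fix i k assume "i < dim_row (1\<^sub>m r :: real mat)" "k < dim_col (1\<^sub>m r :: real mat)"
  hence i: "i < r" and k: "k < r" by auto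
  have "(W * W\<^sup>T) $$ (i, k) = (\<Sum>j<d. W $$ (i, j) * W $$ (k, j))"
    using W i k by (simp add: scalar_prod_def atLeast0LessThan)
  also have "\<dots> = (\<Sum>j<d. if i = k then W $$ (i, j) else 0)"
  proof (intro sum.cong refl)
    fix j assume "j \<in> {..<d}"
    hence j: "j < d" by simp
    show "W $$ (i, j) * W $$ (k, j) = (if i = k then W $$ (i, j) else 0)"
    proof (cases "i = k")
      case True
      thus ?thesis using bool[OF i j] by auto
    next
      case False
      have "W $$ (i, j) + W $$ (k, j) = (\<Sum>l\<in>{i, k}. W $$ (l, j))" using False by simp
      also have "\<dots> \<le> (\<Sum>l<r. W $$ (l, j))"
        using i k bool j by (intro sum_mono2) force+
      also have "\<dots> \<le> 1" using col[OF j] by auto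
      finally show ?thesis using False bool[OF i j] bool[OF k j] by auto
    qed
  qed
  also have "\<dots> = 1\<^sub>m r $$ (i, k)" using i k row by simp
  finally show "(W * W\<^sup>T) $$ (i, k) = 1\<^sub>m r $$ (i, k)" .
qed (use assms in \<open>auto simp: designs_def\<close>)

lemma pos_def_mat_diag:
  assumes pos: "\<And>i. i < n \<Longrightarrow> 0 < f i"
  shows "pos_def_mat (mat_diag n f)"
proof -
  have "0 < x \<bullet> (mat_diag n f *\<^sub>v x)" if x: "x \<in> carrier_vec n" "x \<noteq> 0\<^sub>v n" for x
  proof -
    have diag: "(mat_diag n f *\<^sub>v x) $ i = f i * x $ i" if "i < n" for i
    proof -
      have "(mat_diag n f *\<^sub>v x) $ i = (\<Sum>j<n. (if i = j then f j else 0) * x $ j)"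
        using that x by (simp add: mat_diag_def scalar_prod_def atLeast0LessThan)
      also have "\<dots> = (\<Sum>j<n. if j = i then f i * x $ i else 0)" by (intro sum.cong) auto
      finally show ?thesis using that by simp
    qed
    have "x \<bullet> (mat_diag n f *\<^sub>v x) = (\<Sum>i<n. f i * (x $ i)\<^sup>2)"
      using x diag
      by (auto simp: scalar_prod_def[of x] mat_diag_def atLeast0LessThan power2_eq_square ac_simps
          simp del: index_mult_mat_vec intro!: sum.cong)
    moreover obtain i where "i < n" "x $ i \<noteq> 0" using x by (metis eq_vecI carrier_vecD index_zero_vec)
    hence "0 < (\<Sum>i<n. f i * (x $ i)\<^sup>2)"
      using pos by (intro sum_pos2[of _ i]) (auto intro!: mult_nonneg_nonneg intro: less_imp_le)
    ultimately show ?thesis by simp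
  qed
  moreover have "(mat_diag n f)\<^sup>T = mat_diag n f" by (intro eq_matI) (auto simp: mat_diag_def)
  ultimately show ?thesis unfolding pos_def_mat_def by (auto simp: mat_diag_def)
qed

lemma Gamma_eta_pos_def:
  assumes F: "F \<in> carrier_mat d m" and P: "P \<in> carrier_mat k m"
    and \<Gamma>: "\<Gamma> \<in> carrier_mat m m" "pos_def_mat \<Gamma>"
    and \<sigma>: "\<And>i. i < d \<Longrightarrow> 0 < (\<sigma> i)\<^sup>2"
    and inv: "invertible_mat (Sigma_pr P \<Gamma>)" and W: "W \<in> designs r d"
  shows "Gamma_eta F P \<Gamma> d \<sigma> W \<in> carrier_mat r r" and "pos_def_mat (Gamma_eta F P \<Gamma> d \<sigma> W)"
proof -
  let ?C = "\<Gamma> - \<Gamma> * P\<^sup>T * mat_inv (Sigma_pr P \<Gamma>) * P * \<Gamma>"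
  have Wc: "W \<in> carrier_mat r d" using W unfolding designs_def by auto
  have \<Sigma>: "Sigma_pr P \<Gamma> \<in> carrier_mat k k" unfolding Sigma_pr_def using P \<Gamma> by auto
  have C: "?C \<in> carrier_mat m m"
    using P \<Gamma> mat_inv_facts(3)[OF \<Sigma> inv] by (intro minus_carrier_mat) auto
  have noise: "Gamma_noise d \<sigma> W \<in> carrier_mat r r" "pos_def_mat (Gamma_noise d \<sigma> W)"
    using pos_def_congruence[OF mat_diag_dim pos_def_mat_diag[of d "\<lambda>i. (\<sigma> i)\<^sup>2"], of "W\<^sup>T" r W] \<sigma>
      Wc design_mult_transpose[OF W]
    unfolding Gamma_noise_def by auto
  have FW: "forward F W \<in> carrier_mat r m" unfolding forward_def using Wc F by auto
  have model: "forward F W * ?C * (forward F W)\<^sup>T \<in> carrier_mat r r"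
    "pos_semidef_mat (forward F W * ?C * (forward F W)\<^sup>T)"
    using pos_semidef_congruence[OF C conditional_covariance_pos_semidef[OF \<Gamma> P inv],
        of "(forward F W)\<^sup>T" r]
      FW C by auto
  show "Gamma_eta F P \<Gamma> d \<sigma> W \<in> carrier_mat r r" "pos_def_mat (Gamma_eta F P \<Gamma> d \<sigma> W)"
    unfolding Gamma_eta_def using noise model pos_def_add_pos_semidef[OF noise model] by auto
qed

section \<open>The expected information gain\<close>

theorem theorem3p2:
  fixes d\<^sub>m d\<^sub>\<rho> d r :: nat
    and F\<^sub>d P \<Gamma>\<^sub>p\<^sub>r W :: "real mat"
    and \<sigma> :: "nat \<Rightarrow> real"
  assumes "0 < d\<^sub>m" and "0 < d\<^sub>\<rho>" and "0 < d" and "0 < r" and "r < d"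
    and "F\<^sub>d \<in> carrier_mat d d\<^sub>m"
    and "P \<in> carrier_mat d\<^sub>\<rho> d\<^sub>m"
    and "\<Gamma>\<^sub>p\<^sub>r \<in> carrier_mat d\<^sub>m d\<^sub>m" and "pos_def_mat \<Gamma>\<^sub>p\<^sub>r"
    and "\<And>i. i < d \<Longrightarrow> 0 < (\<sigma> i)\<^sup>2"
    and "invertible_mat (Sigma_pr P \<Gamma>\<^sub>p\<^sub>r)"
    and "W \<in> designs r d"
  shows "invertible_mat (Gamma_eta F\<^sub>d P \<Gamma>\<^sub>p\<^sub>r d \<sigma> W) \<and>
    (\<exists>L. is_cholesky_factor (mat_inv (Gamma_eta F\<^sub>d P \<Gamma>\<^sub>p\<^sub>r d \<sigma> W)) L) \<and>
    (\<forall>L. is_cholesky_factor (mat_inv (Gamma_eta F\<^sub>d P \<Gamma>\<^sub>p\<^sub>r d \<sigma> W)) L \<longrightarrow>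
      Psi_rho F\<^sub>d P \<Gamma>\<^sub>p\<^sub>r d \<sigma> W =
        1 / 2 * ln (det (1\<^sub>m r + L\<^sup>T * W * H_rho F\<^sub>d P \<Gamma>\<^sub>p\<^sub>r * W\<^sup>T * L)))"
proof -
  note F = assms(6) and P = assms(7) and \<Gamma> = assms(8,9) and inv = assms(11)
  define K where "K = Gamma_eta F\<^sub>d P \<Gamma>\<^sub>p\<^sub>r d \<sigma> W"
  have K: "K \<in> carrier_mat r r" "pos_def_mat K"
    unfolding K_def using Gamma_eta_pos_def[OF F P \<Gamma> assms(10) inv assms(12)] by auto
  have K_inv: "invertible_mat K" using pos_def_imp_invertible[OF K] .
  note Ki = mat_inv_facts(3)[OF K(1) K_inv]
  have chol: "\<exists>L. is_cholesky_factor (mat_inv K) L"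
    using cholesky_factor_exists[OF Ki pos_def_mat_inv[OF K]] .
  have "Psi_rho F\<^sub>d P \<Gamma>\<^sub>p\<^sub>r d \<sigma> W =
        1 / 2 * ln (det (1\<^sub>m r + L\<^sup>T * W * H_rho F\<^sub>d P \<Gamma>\<^sub>p\<^sub>r * W\<^sup>T * L))"
    if "is_cholesky_factor (mat_inv K) L" for L
  proof -
    have L: "L \<in> carrier_mat r r" and KL: "mat_inv K = L * L\<^sup>T"
      using that Ki unfolding is_cholesky_factor_def by auto
    have W: "W \<in> carrier_mat r d" using assms(12) unfolding designs_def by auto
    define \<Sigma> where "\<Sigma> = Sigma_pr P \<Gamma>\<^sub>p\<^sub>r"
    define S where "S = mat_sqrt \<Sigma>"
    define J where "J = mat_inv \<Sigma>"
    define G where "G = forward F\<^sub>d W * P_dagger P \<Gamma>\<^sub>p\<^sub>r"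
    have \<Sigma>: "\<Sigma> \<in> carrier_mat d\<^sub>\<rho> d\<^sub>\<rho>" unfolding \<Sigma>_def Sigma_pr_def using P \<Gamma> by auto
    have pd: "pos_def_mat \<Sigma>" unfolding \<Sigma>_def by (rule Sigma_pr_pos_def[OF \<Gamma> P inv])
    note inv' = inv[folded \<Sigma>_def]
    have sym: "\<Gamma>\<^sub>p\<^sub>r\<^sup>T = \<Gamma>\<^sub>p\<^sub>r" "\<Sigma>\<^sup>T = \<Sigma>" using \<Gamma> pd unfolding pos_def_mat_def by auto
    have S: "S \<in> carrier_mat d\<^sub>\<rho> d\<^sub>\<rho>" and SS: "S * S = \<Sigma>"
      unfolding S_def using mat_sqrt_facts[OF \<Sigma> pd] by auto
    have J: "J \<in> carrier_mat d\<^sub>\<rho> d\<^sub>\<rho>" and J\<Sigma>: "J * \<Sigma> = 1\<^sub>m d\<^sub>\<rho>" and symJ: "J\<^sup>T = J"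
      unfolding J_def using mat_inv_facts[OF \<Sigma> inv'] mat_inv_symmetric[OF \<Sigma> inv' sym(2)] by auto
    have G_eq: "G = W * F\<^sub>d * (\<Gamma>\<^sub>p\<^sub>r * P\<^sup>T * J)"
      unfolding G_def forward_def P_dagger_def J_def \<Sigma>_def ..
    have G: "G \<in> carrier_mat r d\<^sub>\<rho>" unfolding G_eq using W F \<Gamma> P J by auto
    have "G * \<Sigma> * G\<^sup>T = W * F\<^sub>d * \<Gamma>\<^sub>p\<^sub>r * P\<^sup>T * (J * (\<Sigma> * (J * (P * \<Gamma>\<^sub>p\<^sub>r * F\<^sub>d\<^sup>T * W\<^sup>T))))"
      unfolding G_eq using W F \<Gamma> P J \<Sigma> sym symJ
      by (simp add: assoc_mult_mat_dim transpose_mult_dim)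
    also have "\<dots> = W * H_rho F\<^sub>d P \<Gamma>\<^sub>p\<^sub>r * W\<^sup>T"
      unfolding H_rho_def \<Sigma>_def[symmetric] J_def[symmetric] using W F \<Gamma> P J \<Sigma>
      by (subst mult_cancel_left_mat[OF J\<Sigma>]) (auto simp: assoc_mult_mat_dim)
    finally have GG: "G * \<Sigma> * G\<^sup>T = W * H_rho F\<^sub>d P \<Gamma>\<^sub>p\<^sub>r * W\<^sup>T" .
    have H: "H_rho F\<^sub>d P \<Gamma>\<^sub>p\<^sub>r \<in> carrier_mat d d"
      unfolding H_rho_def \<Sigma>_def[symmetric] J_def[symmetric] using F \<Gamma> P J by auto
    have "S * G\<^sup>T * mat_inv K * G * S = (S * G\<^sup>T * L) * (L\<^sup>T * G * S)"
      unfolding KL using S G L by (simp add: assoc_mult_mat_dim)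
    hence "det (1\<^sub>m d\<^sub>\<rho> + S * G\<^sup>T * mat_inv K * G * S)
        = det (1\<^sub>m r + (L\<^sup>T * G * S) * (S * G\<^sup>T * L))"
      using det_one_plus_mult_commute[of "S * G\<^sup>T * L" d\<^sub>\<rho> r "L\<^sup>T * G * S"] S G L by simp
    also have "(L\<^sup>T * G * S) * (S * G\<^sup>T * L) = L\<^sup>T * (G * (S * S) * G\<^sup>T) * L"
      using S G L by (simp add: assoc_mult_mat_dim)
    also have "\<dots> = L\<^sup>T * W * H_rho F\<^sub>d P \<Gamma>\<^sub>p\<^sub>r * W\<^sup>T * L"
      unfolding SS GG using W H L by (simp add: assoc_mult_mat_dim)
    finally show ?thesis
      unfolding Psi_rho_def using P by (simp add: K_def S_def G_def \<Sigma>_def)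
  qed
  thus ?thesis using K_inv chol unfolding K_def by blast
qed

end
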